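(* Let $a\in\mathbb R$ and $\tau>0$ satisfy $a\tau<1$, let $\hat{\boldsymbol x}\in\mathbb R^n$, and consider the system consisting of the approximating SDE $$(1-a\tau)\frac{\mathrm d\boldsymbol X(t)}{\mathrm dt}=-\nabla\tilde V(\boldsymbol X(t))+\boldsymbol\sigma(\boldsymbol X(t))\boldsymbol\xi(t),\qquad \tilde V(\boldsymbol x)=V(\boldsymbol x)+\frac a2|\boldsymbol x-\hat{\boldsymbol x}|^2,$$ and the noise filter SDE $$\frac{\mathrm d\boldsymbol\xi(t)}{\mathrm dt}=\boldsymbol\alpha(\boldsymbol\xi(t))+\boldsymbol\beta(\boldsymbol\xi(t))\boldsymbol\xi^{\mathrm{WN}}(t),$$ where $\boldsymbol\xi^{\mathrm{WN}}(t)$ is a standard $m$-dimensional Gaussian white noise. Defining the rescaled time $s=t/(1-a\tau)$, this SDE system can be expressed equivalently as $$\frac{\mathrm d\boldsymbol X(s)}{\mathrm ds}=-\nabla\tilde V(\boldsymbol X(s))+\boldsymbol\sigma(\boldsymbol X(s))\boldsymbol\xi(s),$$ $$\frac{\mathrm d\boldsymbol\xi(s)}{\mathrm ds}=(1-a\tau)\,\boldsymbol\alpha(\boldsymbol\xi(s))+\sqrt{1-a\tau}\,\boldsymbol\beta(\boldsymbol\xi(s))\,\boldsymbol\xi^{\mathrm{WN}}(s),$$ where $\boldsymbol\xi^{\mathrm{WN}}(s)$ is a standard white noise (in the time variable $s$).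
   Context: Here $V:\mathbb R^n\to\mathbb R$ is a (differentiable) potential, $\boldsymbol X(t)\in\mathbb R^n$ is the state process, $\boldsymbol\xi(t)\in\mathbb R^m$ is the colored noise excitation, $\boldsymbol\sigma(\boldsymbol x)\in\mathbb R^{n\times m}$ is the noise intensity, and $\boldsymbol\alpha:\mathbb R^m\to\mathbb R^m$, $\boldsymbol\beta:\mathbb R^m\to\mathbb R^{m\times m}$ are prescribed drift and diffusion functions. Standard $m$-dimensional Gaussian white noise $\boldsymbol\xi^{\mathrm{WN}}$ is the zero-mean Gaussian (generalized) process with autocorrelation $\mathbb E[\boldsymbol\xi^{\mathrm{WN}}(t_1)(\boldsymbol\xi^{\mathrm{WN}}(t_2))^T]=\boldsymbol I\,\delta(t_1-t_2)$, where $\boldsymbol I$ is the $m\times m$ identity; it is the formal time derivative of the standard Wiener process. Notational convention: with $t(s)=(1-a\tau)s$, the processes in rescaled time are $\boldsymbol X(s):=\boldsymbol X(t(s))$ and $\boldsymbol\xi(s):=\boldsymbol\xi(t(s))$. The white noise $\boldsymbol\xi^{\mathrm{WN}}(s)$ in the rescaled system is a standard white noise in $s$; it is not the composition of the original white noise with $t(s)$. *)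

theory Defs
  imports "HOL-Probability.Probability"
begin

definition gradient :: "('a::euclidean_space \<Rightarrow> real) \<Rightarrow> 'a \<Rightarrow> 'a" where
  "gradient f x = (THE D. GDERIV f x :> D)"

text \<open>Test functions: smooth with compact support in the open half line. Time runs over
  \<open>[0, \<infinity>)\<close>, so generalized processes are tested on its interior.\<close>

definition test_function :: "(real \<Rightarrow> real) \<Rightarrow> bool" where
  "test_function \<phi> \<longleftrightarrow>
     (\<forall>k t. (deriv ^^ k) \<phi> field_differentiable (at t)) \<and>
     compact (closure {t. \<phi> t \<noteq> 0}) \<and> closure {t. \<phi> t \<noteq> 0} \<subseteq> {0<..}"

text \<open>A real Gaussian random variable, almost surely constant ones included.\<close>

definition gaussian_rv :: "'w measure \<Rightarrow> ('w \<Rightarrow> real) \<Rightarrow> bool" where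
  "gaussian_rv M Z \<longleftrightarrow>
     Z \<in> borel_measurable M \<and>
     ((\<exists>\<mu>. AE \<omega> in M. Z \<omega> = \<mu>) \<or>
      (\<exists>\<mu> \<sigma>. 0 < \<sigma> \<and> distributed M lborel Z (normal_density \<mu> \<sigma>)))"

text \<open>A generalized process \<open>N\<close> assigns to a test function \<open>\<phi>\<close> the random vector that is formally
  \<open>\<integral> \<phi>(t) N(t) dt\<close>. The last clause is the autocorrelation \<open>I \<delta>(t1 - t2)\<close> paired with
  \<open>\<phi>(t1) \<psi>(t2)\<close>. Linearity and mean-square continuity of \<open>N\<close> follow from it.\<close>

definition standard_white_noise ::
  "'w measure \<Rightarrow> ((real \<Rightarrow> real) \<Rightarrow> 'w \<Rightarrow> real ^ 'm) \<Rightarrow> bool" where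
  "standard_white_noise M N \<longleftrightarrow>
     (\<forall>(k::nat) \<Phi> v. (\<forall>i<k. test_function (\<Phi> i)) \<longrightarrow>
        gaussian_rv M (\<lambda>\<omega>. \<Sum>i<k. v i \<bullet> N (\<Phi> i) \<omega>)) \<and>
     (\<forall>\<phi>. test_function \<phi> \<longrightarrow> (LINT \<omega>|M. N \<phi> \<omega>) = 0) \<and>
     (\<forall>\<phi> \<psi>. test_function \<phi> \<longrightarrow> test_function \<psi> \<longrightarrow>
        (\<chi> i j. LINT \<omega>|M. N \<phi> \<omega> $ i * N \<psi> \<omega> $ j) = (LINT t|lborel. \<phi> t * \<psi> t) *\<^sub>R mat 1)"

text \<open>White noise in the time \<open>s = t / c\<close>: formally \<open>N'(s) = sqrt c * N(c * s)\<close>, that is,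
  \<open>\<integral> \<phi>(s) N'(s) ds = (1 / sqrt c) \<integral> \<phi>(t / c) N(t) dt\<close>.\<close>

definition rescale_noise ::
  "real \<Rightarrow> ((real \<Rightarrow> real) \<Rightarrow> 'w \<Rightarrow> real ^ 'm) \<Rightarrow> (real \<Rightarrow> real) \<Rightarrow> 'w \<Rightarrow> real ^ 'm" where
  "rescale_noise c N \<phi> \<omega> = (1 / sqrt c) *\<^sub>R N (\<lambda>t. \<phi> (t / c)) \<omega>"

definition continuous_adapted ::
  "'w measure \<Rightarrow> (real \<Rightarrow> 'w measure) \<Rightarrow> (real \<Rightarrow> 'w \<Rightarrow> 'b::topological_space) \<Rightarrow> bool" where
  "continuous_adapted M F Y \<longleftrightarrow>
     (\<forall>t\<ge>0. Y t \<in> borel_measurable (F t)) \<and>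
     (\<forall>\<omega>\<in>space M. continuous_on {0..} (\<lambda>t. Y t \<omega>))"

definition wiener_process ::
  "'w measure \<Rightarrow> (real \<Rightarrow> 'w measure) \<Rightarrow> (real \<Rightarrow> 'w \<Rightarrow> real ^ 'm) \<Rightarrow> bool" where
  "wiener_process M F W \<longleftrightarrow>
     continuous_adapted M F W \<and>
     (AE \<omega> in M. W 0 \<omega> = 0) \<and>
     (\<forall>s t. 0 \<le> s \<longrightarrow> s < t \<longrightarrow>
        prob_space.indep_set M (sets (F s))
          {(\<lambda>\<omega>. W t \<omega> - W s \<omega>) -` A \<inter> space M | A. A \<in> sets borel} \<and>
        prob_space.indep_vars M (\<lambda>_. borel) (\<lambda>j \<omega>. (W t \<omega> - W s \<omega>) $ j) UNIV \<and>
        (\<forall>j. distributed M lborel (\<lambda>\<omega>. (W t \<omega> - W s \<omega>) $ j) (normal_density 0 (sqrt (t - s)))))"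

definition formal_derivative ::
  "'w measure \<Rightarrow> (real \<Rightarrow> 'w \<Rightarrow> real ^ 'm) \<Rightarrow> ((real \<Rightarrow> real) \<Rightarrow> 'w \<Rightarrow> real ^ 'm) \<Rightarrow> bool" where
  "formal_derivative M W N \<longleftrightarrow>
     (\<forall>\<phi>. test_function \<phi> \<longrightarrow>
        (AE \<omega> in M. N \<phi> \<omega> = - (LINT t|lborel. deriv \<phi> t *\<^sub>R W t \<omega>)))"

text \<open>Sets that are not measurable have \<open>measure\<close> zero, so measurability is part of the definition.\<close>

definition tends_in_prob ::
  "'w measure \<Rightarrow> (nat \<Rightarrow> 'w \<Rightarrow> 'b::metric_space) \<Rightarrow> ('w \<Rightarrow> 'b) \<Rightarrow> bool" where
  "tends_in_prob M Z Y \<longleftrightarrow>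
     (\<forall>k. Z k \<in> borel_measurable M) \<and> Y \<in> borel_measurable M \<and>
     (\<forall>\<epsilon>>0. (\<lambda>k. measure M {\<omega>\<in>space M. \<epsilon> < dist (Z k \<omega>) (Y \<omega>)}) \<longlonglongrightarrow> 0)"

definition progressively_measurable ::
  "(real \<Rightarrow> 'w measure) \<Rightarrow> (real \<Rightarrow> 'w \<Rightarrow> 'b::topological_space) \<Rightarrow> bool" where
  "progressively_measurable F H \<longleftrightarrow>
     (\<forall>t\<ge>0. (\<lambda>(u, \<omega>). H u \<omega>) \<in> borel_measurable (restrict_space borel {0..t} \<Otimes>\<^sub>M F t))"

text \<open>The data \<open>n\<close>, \<open>p\<close>, \<open>\<eta>\<close> encode the simple predictable process with value \<open>\<eta> i\<close> on
  \<open>(p i, p (i + 1)]\<close>.\<close>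

definition simple_integrand ::
  "'w measure \<Rightarrow> (real \<Rightarrow> 'w measure) \<Rightarrow> real \<Rightarrow> nat \<Rightarrow> (nat \<Rightarrow> real) \<Rightarrow>
     (nat \<Rightarrow> 'w \<Rightarrow> 'b::real_normed_vector) \<Rightarrow> bool" where
  "simple_integrand M F t n p \<eta> \<longleftrightarrow>
     (\<forall>i<n. 0 \<le> p i \<and> p i \<le> p (Suc i) \<and> p (Suc i) \<le> t \<and>
        \<eta> i \<in> borel_measurable (F (p i)) \<and> (\<exists>B. \<forall>\<omega>\<in>space M. norm (\<eta> i \<omega>) \<le> B))"

definition simple_process ::
  "nat \<Rightarrow> (nat \<Rightarrow> real) \<Rightarrow> (nat \<Rightarrow> 'w \<Rightarrow> 'b::real_normed_vector) \<Rightarrow> real \<Rightarrow> 'w \<Rightarrow> 'b" where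
  "simple_process n p \<eta> u \<omega> = (\<Sum>i<n. indicator {p i<..p (Suc i)} u *\<^sub>R \<eta> i \<omega>)"

definition simple_integral ::
  "(real \<Rightarrow> 'w \<Rightarrow> real ^ 'm) \<Rightarrow> nat \<Rightarrow> (nat \<Rightarrow> real) \<Rightarrow> (nat \<Rightarrow> 'w \<Rightarrow> real ^ 'm ^ 'k) \<Rightarrow>
     'w \<Rightarrow> real ^ 'k" where
  "simple_integral W n p \<eta> \<omega> = (\<Sum>i<n. \<eta> i \<omega> *v (W (p (Suc i)) \<omega> - W (p i) \<omega>))"

text \<open>\<open>J = \<integral>\<^sub>0\<^sup>t H dW\<close> in the sense of Ito: limit in probability of the integrals of simple processes
  that approximate \<open>H\<close> in \<open>L\<^sup>2[0,t]\<close>, in probability.\<close>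

definition has_ito_integral ::
  "'w measure \<Rightarrow> (real \<Rightarrow> 'w measure) \<Rightarrow> (real \<Rightarrow> 'w \<Rightarrow> real ^ 'm) \<Rightarrow>
     (real \<Rightarrow> 'w \<Rightarrow> real ^ 'm ^ 'k) \<Rightarrow> real \<Rightarrow> ('w \<Rightarrow> real ^ 'k) \<Rightarrow> bool" where
  "has_ito_integral M F W H t J \<longleftrightarrow>
     progressively_measurable F H \<and>
     (\<exists>n p \<eta>. (\<forall>k. simple_integrand M F t (n k) (p k) (\<eta> k)) \<and>
        (\<forall>\<epsilon>>0. (\<lambda>k. measure M {\<omega>\<in>space M.
           ennreal \<epsilon> < (\<integral>\<^sup>+u\<in>{0..t}. ennreal ((norm (H u \<omega> - simple_process (n k) (p k) (\<eta> k) u \<omega>))\<^sup>2) \<partial>lborel)})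
           \<longlonglongrightarrow> 0) \<and>
        tends_in_prob M (\<lambda>k. simple_integral W (n k) (p k) (\<eta> k)) J)"

definition is_partition :: "real \<Rightarrow> nat \<Rightarrow> (nat \<Rightarrow> real) \<Rightarrow> bool" where
  "is_partition t n p \<longleftrightarrow> p 0 = 0 \<and> p n = t \<and> (\<forall>i<n. p i \<le> p (Suc i))"

text \<open>Stratonovich integral: limit in probability of trapezoidal sums along every sequence of
  partitions of \<open>[0,t]\<close> whose mesh tends to zero.\<close>

definition has_stratonovich_integral ::
  "'w measure \<Rightarrow> (real \<Rightarrow> 'w measure) \<Rightarrow> (real \<Rightarrow> 'w \<Rightarrow> real ^ 'm) \<Rightarrow>
     (real \<Rightarrow> 'w \<Rightarrow> real ^ 'm ^ 'k) \<Rightarrow> real \<Rightarrow> ('w \<Rightarrow> real ^ 'k) \<Rightarrow> bool" where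
  "has_stratonovich_integral M F W H t J \<longleftrightarrow>
     progressively_measurable F H \<and>
     (\<forall>n p. (\<forall>k. is_partition t (n k) (p k)) \<longrightarrow>
        (\<forall>\<delta>>0. \<forall>\<^sub>F k in sequentially. \<forall>i<n k. p k (Suc i) - p k i < \<delta>) \<longrightarrow>
        tends_in_prob M
          (\<lambda>k \<omega>. \<Sum>i<n k. ((1/2) *\<^sub>R (H (p k i) \<omega> + H (p k (Suc i)) \<omega>)) *v
                          (W (p k (Suc i)) \<omega> - W (p k i) \<omega>)) J)"

datatype noise_convention = Ito | Stratonovich

fun has_stochastic_integral ::
  "noise_convention \<Rightarrow> 'w measure \<Rightarrow> (real \<Rightarrow> 'w measure) \<Rightarrow> (real \<Rightarrow> 'w \<Rightarrow> real ^ 'm) \<Rightarrow>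
     (real \<Rightarrow> 'w \<Rightarrow> real ^ 'm ^ 'k) \<Rightarrow> real \<Rightarrow> ('w \<Rightarrow> real ^ 'k) \<Rightarrow> bool" where
  "has_stochastic_integral Ito M F W H t J = has_ito_integral M F W H t J"
| "has_stochastic_integral Stratonovich M F W H t J = has_stratonovich_integral M F W H t J"

text \<open>\<open>k dX/dt = - g(X) + \<sigma>(X) \<xi>\<close>. The excitation \<open>\<xi>\<close> has continuous paths, so the time derivative
  is an ordinary one, path by path (one-sided at \<open>t = 0\<close>).\<close>

definition state_equation ::
  "'w measure \<Rightarrow> real \<Rightarrow> (real ^ 'n \<Rightarrow> real ^ 'n) \<Rightarrow> (real ^ 'n \<Rightarrow> real ^ 'm ^ 'n) \<Rightarrow>
     (real \<Rightarrow> 'w \<Rightarrow> real ^ 'n) \<Rightarrow> (real \<Rightarrow> 'w \<Rightarrow> real ^ 'm) \<Rightarrow> bool" where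
  "state_equation M k g \<sigma> X \<xi> \<longleftrightarrow>
     (AE \<omega> in M. \<forall>t\<ge>0. \<exists>D. ((\<lambda>u. X u \<omega>) has_vector_derivative D) (at t within {0..}) \<and>
        k *\<^sub>R D = - g (X t \<omega>) + \<sigma> (X t \<omega>) *v \<xi> t \<omega>)"

text \<open>\<open>d\<xi>/dt = A(\<xi>) + B(\<xi>) N\<close>, read as the integral equation driven by the Wiener process whose
  formal derivative is \<open>N\<close>.\<close>

definition filter_equation ::
  "noise_convention \<Rightarrow> 'w measure \<Rightarrow> (real \<Rightarrow> 'w measure) \<Rightarrow>
     (real ^ 'm \<Rightarrow> real ^ 'm) \<Rightarrow> (real ^ 'm \<Rightarrow> real ^ 'm ^ 'm) \<Rightarrow>
     ((real \<Rightarrow> real) \<Rightarrow> 'w \<Rightarrow> real ^ 'm) \<Rightarrow> (real \<Rightarrow> 'w \<Rightarrow> real ^ 'm) \<Rightarrow> bool" where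
  "filter_equation conv M F A B N \<xi> \<longleftrightarrow>
     (\<exists>W. wiener_process M F W \<and> formal_derivative M W N \<and>
        (\<forall>t\<ge>0. \<exists>J. has_stochastic_integral conv M F W (\<lambda>u \<omega>. B (\<xi> u \<omega>)) t J \<and>
           (AE \<omega> in M. set_integrable lborel {0..t} (\<lambda>u. A (\<xi> u \<omega>)) \<and>
              \<xi> t \<omega> = \<xi> 0 \<omega> + (LINT u:{0..t}|lborel. A (\<xi> u \<omega>)) + J \<omega>)))"

definition solves_system ::
  "noise_convention \<Rightarrow> 'w measure \<Rightarrow> (real \<Rightarrow> 'w measure) \<Rightarrow>
     real \<Rightarrow> (real ^ 'n \<Rightarrow> real ^ 'n) \<Rightarrow> (real ^ 'n \<Rightarrow> real ^ 'm ^ 'n) \<Rightarrow>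
     (real ^ 'm \<Rightarrow> real ^ 'm) \<Rightarrow> (real ^ 'm \<Rightarrow> real ^ 'm ^ 'm) \<Rightarrow>
     ((real \<Rightarrow> real) \<Rightarrow> 'w \<Rightarrow> real ^ 'm) \<Rightarrow>
     (real \<Rightarrow> 'w \<Rightarrow> real ^ 'n) \<Rightarrow> (real \<Rightarrow> 'w \<Rightarrow> real ^ 'm) \<Rightarrow> bool" where
  "solves_system conv M F k g \<sigma> A B N X \<xi> \<longleftrightarrow>
     filtration (space M) F \<and> (\<forall>t. subalgebra M (F t)) \<and>
     continuous_adapted M F X \<and> continuous_adapted M F \<xi> \<and>
     standard_white_noise M N \<and>
     state_equation M k g \<sigma> X \<xi> \<and>
     filter_equation conv M F A B N \<xi>"

end

theory Submission
  imports Defs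
begin

text \<open>The proof is Brownian scaling. If \<open>W\<close> is a Wiener process and \<open>c > 0\<close>, then so is
  \<open>W'(s) = W(c s) / sqrt c\<close>, with respect to the filtration read in the new clock: the increment of
  \<open>W\<close> over \<open>[c s, c t]\<close> has variance \<open>c (t - s)\<close>, and the factor \<open>1 / sqrt c\<close> cancels the \<open>c\<close>. The
  formal derivative of \<open>W'\<close> is \<open>sqrt c N(c s)\<close>, where \<open>N\<close> is that of \<open>W\<close>, so a stochastic integral
  \<open>\<integral> H dW\<close> over \<open>[0, c s]\<close> equals \<open>\<integral> (sqrt c H(c u)) dW'(u)\<close> over \<open>[0, s]\<close>. This is where the factor
  \<open>sqrt c\<close> in front of \<open>\<beta>\<close> comes from; the factor \<open>c\<close> in front of \<open>\<alpha>\<close> is the Jacobian of \<open>t = c s\<close> in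
  the drift integral, and the same Jacobian, by the chain rule, turns the coefficient \<open>k\<close> of the state
  equation into \<open>k / c\<close>. Both notions of stochastic integral are limits of Riemann type sums; a sum
  in one clock equals, path by path, the sum in the other clock over the rescaled partition, so the
  two integrals are limits of the same random variables
  (\<open>has_ito_integral_rescale\<close>, \<open>has_stratonovich_integral_rescale\<close>).

  All this shows that scaling time by any \<open>c > 0\<close> maps solutions to solutions
  (\<open>solves_system_rescale\<close>). Scalings form a group, so the converse is the same statement for
  \<open>1 / c\<close>. The theorem is the case \<open>c = 1 - a \<tau>\<close>, where the coefficient \<open>k = c\<close> becomes 1.\<close>

section \<open>Rescaled test functions\<close>

lemma higher_deriv_rescale:
  fixes \<phi> :: "real \<Rightarrow> real"
  assumes "\<And>k t. (deriv ^^ k) \<phi> field_differentiable (at t)"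
  shows "(deriv ^^ k) (\<lambda>t. \<phi> (t / c)) = (\<lambda>t. (1 / c) ^ k * (deriv ^^ k) \<phi> (t / c))"
proof (induction k)
  case 0
  show ?case by simp
next
  case (Suc k)
  have "((\<lambda>t. (1 / c) ^ k * (deriv ^^ k) \<phi> (t / c)) has_field_derivative
          (1 / c) ^ k * ((deriv ^^ Suc k) \<phi> (t / c) * (1 / c))) (at t)" for t
  proof -
    have "((deriv ^^ k) \<phi> has_field_derivative (deriv ^^ Suc k) \<phi> (t / c)) (at (t / c))"
      using assms[of k "t / c"] by (simp add: DERIV_deriv_iff_field_differentiable)
    moreover have "((\<lambda>t. t / c) has_field_derivative 1 / c) (at t)"
      by (auto intro!: derivative_eq_intros simp: divide_inverse)
    ultimately show ?thesis
      by (intro DERIV_cmult DERIV_chain2)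
  qed
  then have "deriv (\<lambda>t. (1 / c) ^ k * (deriv ^^ k) \<phi> (t / c))
      = (\<lambda>t. (1 / c) ^ k * ((deriv ^^ Suc k) \<phi> (t / c) * (1 / c)))"
    by (intro ext DERIV_imp_deriv)
  with Suc.IH have "(deriv ^^ Suc k) (\<lambda>t. \<phi> (t / c))
      = (\<lambda>t. (1 / c) ^ k * ((deriv ^^ Suc k) \<phi> (t / c) * (1 / c)))"
    by (simp only: funpow.simps(2) o_apply)
  then show ?case
    by (simp only: power_Suc ac_simps)
qed

lemma test_function_rescale:
  assumes \<phi>: "test_function \<phi>" and c: "0 < c"
  shows "test_function (\<lambda>t. \<phi> (t / c))"
proof -
  have smooth: "(deriv ^^ k) \<phi> field_differentiable (at t)" for k t
    using \<phi> by (simp add: test_function_def)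
  have "(deriv ^^ k) (\<lambda>t. \<phi> (t / c)) field_differentiable (at t)" for k t
  proof -
    have "((deriv ^^ k) \<phi> \<circ> (\<lambda>t. t / c)) field_differentiable (at t)"
      by (rule field_differentiable_compose[OF _ smooth])
         (auto intro!: derivative_intros simp: c less_imp_neq field_differentiable_def divide_inverse)
    then have "(\<lambda>t. (1 / c) ^ k * (deriv ^^ k) \<phi> (t / c)) field_differentiable (at t)"
      by (intro field_differentiable_mult) (simp_all add: o_def)
    then show ?thesis
      by (simp only: higher_deriv_rescale[OF smooth])
  qed
  moreover have "{t. \<phi> (t / c) \<noteq> 0} = (*\<^sub>R) c ` {t. \<phi> t \<noteq> 0}"
  proof (intro set_eqI iffI)
    fix x assume "x \<in> {t. \<phi> (t / c) \<noteq> 0}"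
    then show "x \<in> (*\<^sub>R) c ` {t. \<phi> t \<noteq> 0}"
      using c by (intro image_eqI[of _ _ "x / c"]) auto
  qed (use c in auto)
  then have "closure {t. \<phi> (t / c) \<noteq> 0} = (*\<^sub>R) c ` closure {t. \<phi> t \<noteq> 0}"
    by (simp only: closure_scaleR)
  moreover have "compact ((*\<^sub>R) c ` closure {t. \<phi> t \<noteq> 0})"
    using \<phi> by (intro compact_scaling) (simp only: test_function_def)
  moreover have "(*\<^sub>R) c ` closure {t. \<phi> t \<noteq> 0} \<subseteq> {0<..}"
    using \<phi> c by (auto simp: test_function_def)
  ultimately show ?thesis
    unfolding test_function_def by metis
qed

lemma deriv_test_function_rescale:
  assumes "test_function \<phi>"
  shows "deriv (\<lambda>t. \<phi> (t / c)) t = deriv \<phi> (t / c) / c"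
  using higher_deriv_rescale[of \<phi> 1 c] assms by (simp add: test_function_def)

section \<open>White noise and Wiener processes in a new clock\<close>

lemma rescale_noise_inverse:
  assumes "0 < c"
  shows "rescale_noise (1 / c) (rescale_noise c N) = N"
  using assms by (simp add: rescale_noise_def fun_eq_iff real_sqrt_divide)

lemma standard_white_noise_rescale:
  fixes N :: "(real \<Rightarrow> real) \<Rightarrow> 'w \<Rightarrow> real ^ 'm"
  assumes N: "standard_white_noise M N" and c: "0 < c"
  shows "standard_white_noise M (rescale_noise c N)"
  unfolding standard_white_noise_def
proof (intro conjI allI impI)
  fix k :: nat and \<Phi> :: "nat \<Rightarrow> real \<Rightarrow> real" and v :: "nat \<Rightarrow> real ^ 'm"
  assume "\<forall>i<k. test_function (\<Phi> i)"
  then have "\<forall>i<k. test_function (\<lambda>t. \<Phi> i (t / c))"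
    using c by (simp add: test_function_rescale)
  then have "gaussian_rv M (\<lambda>\<omega>. \<Sum>i<k. ((1 / sqrt c) *\<^sub>R v i) \<bullet> N (\<lambda>t. \<Phi> i (t / c)) \<omega>)"
    using N[unfolded standard_white_noise_def, THEN conjunct1, rule_format,
        of k "\<lambda>i t. \<Phi> i (t / c)" "\<lambda>i. (1 / sqrt c) *\<^sub>R v i"] by simp
  then show "gaussian_rv M (\<lambda>\<omega>. \<Sum>i<k. v i \<bullet> rescale_noise c N (\<Phi> i) \<omega>)"
    by (simp add: rescale_noise_def)
next
  fix \<phi> assume "test_function \<phi>"
  then have "(LINT \<omega>|M. N (\<lambda>t. \<phi> (t / c)) \<omega>) = 0"
    using N c by (simp add: standard_white_noise_def test_function_rescale)
  then show "(LINT \<omega>|M. rescale_noise c N \<phi> \<omega>) = 0"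
    by (simp add: rescale_noise_def)
next
  fix \<phi> \<psi> assume "test_function \<phi>" "test_function \<psi>"
  then have *: "(\<chi> i j. LINT \<omega>|M. N (\<lambda>t. \<phi> (t / c)) \<omega> $ i * N (\<lambda>t. \<psi> (t / c)) \<omega> $ j)
      = (LINT t|lborel. \<phi> (t / c) * \<psi> (t / c)) *\<^sub>R mat 1"
    using N c by (simp add: standard_white_noise_def test_function_rescale)
  have "(\<chi> i j. LINT \<omega>|M. rescale_noise c N \<phi> \<omega> $ i * rescale_noise c N \<psi> \<omega> $ j)
      = (1 / c) *\<^sub>R (\<chi> i j. LINT \<omega>|M. N (\<lambda>t. \<phi> (t / c)) \<omega> $ i * N (\<lambda>t. \<psi> (t / c)) \<omega> $ j)"
    using c by (simp add: rescale_noise_def vec_eq_iff)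
  also have "\<dots> = ((1 / c) * (LINT t|lborel. \<phi> (t / c) * \<psi> (t / c))) *\<^sub>R mat 1"
    by (simp add: *)
  also have "(1 / c) * (LINT t|lborel. \<phi> (t / c) * \<psi> (t / c)) = (LINT t|lborel. \<phi> t * \<psi> t)"
    using lborel_integral_real_affine[of c "\<lambda>t. \<phi> (t / c) * \<psi> (t / c)" 0] c by simp
  finally show "(\<chi> i j. LINT \<omega>|M. rescale_noise c N \<phi> \<omega> $ i * rescale_noise c N \<psi> \<omega> $ j)
      = (LINT t|lborel. \<phi> t * \<psi> t) *\<^sub>R mat 1" .
qed

definition rescale_wiener :: "real \<Rightarrow> (real \<Rightarrow> 'w \<Rightarrow> real ^ 'm) \<Rightarrow> real \<Rightarrow> 'w \<Rightarrow> real ^ 'm" where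
  "rescale_wiener c W s \<omega> = (1 / sqrt c) *\<^sub>R W (c * s) \<omega>"

lemma rescale_wiener_diff:
  "rescale_wiener c W t \<omega> - rescale_wiener c W s \<omega> = (1 / sqrt c) *\<^sub>R (W (c * t) \<omega> - W (c * s) \<omega>)"
  by (simp add: rescale_wiener_def scaleR_diff_right)

lemma continuous_adapted_rescale:
  assumes Y: "continuous_adapted M F Y" and c: "0 < c"
  shows "continuous_adapted M (\<lambda>s. F (c * s)) (\<lambda>s. Y (c * s))"
  unfolding continuous_adapted_def
proof (intro conjI allI impI ballI)
  fix t :: real assume "0 \<le> t"
  then show "Y (c * t) \<in> borel_measurable (F (c * t))"
    using Y c by (simp add: continuous_adapted_def)
next
  fix \<omega> assume "\<omega> \<in> space M"
  then have "continuous_on {0..} (\<lambda>t. Y t \<omega>)"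
    using Y by (simp add: continuous_adapted_def)
  then show "continuous_on {0..} (\<lambda>t. Y (c * t) \<omega>)"
    by (rule continuous_on_compose2) (use c in \<open>auto intro!: continuous_intros\<close>)
qed

lemma wiener_process_rescale:
  fixes W :: "real \<Rightarrow> 'w \<Rightarrow> real ^ 'm"
  assumes M: "prob_space M" and W: "wiener_process M F W" and c: "0 < c"
  shows "wiener_process M (\<lambda>s. F (c * s)) (rescale_wiener c W)"
  unfolding wiener_process_def
proof (intro conjI allI impI)
  interpret prob_space M by (rule M)
  have WF: "continuous_adapted M (\<lambda>s. F (c * s)) (\<lambda>s. W (c * s))"
    using W c by (intro continuous_adapted_rescale) (simp_all add: wiener_process_def)
  show "continuous_adapted M (\<lambda>s. F (c * s)) (rescale_wiener c W)"
    unfolding continuous_adapted_def rescale_wiener_def[abs_def]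
  proof (intro conjI allI impI ballI)
    fix t :: real assume "0 \<le> t"
    then have "W (c * t) \<in> borel_measurable (F (c * t))"
      using WF by (simp only: continuous_adapted_def)
    then show "(\<lambda>\<omega>. (1 / sqrt c) *\<^sub>R W (c * t) \<omega>) \<in> borel_measurable (F (c * t))"
      by (rule borel_measurable_scaleR[OF borel_measurable_const])
  next
    fix \<omega> assume "\<omega> \<in> space M"
    then have "continuous_on {0..} (\<lambda>t. W (c * t) \<omega>)"
      using WF by (simp only: continuous_adapted_def)
    then show "continuous_on {0..} (\<lambda>t. (1 / sqrt c) *\<^sub>R W (c * t) \<omega>)"
      by (rule continuous_on_scaleR[OF continuous_on_const])
  qed
  show "AE \<omega> in M. rescale_wiener c W 0 \<omega> = 0"
    using W by (auto simp: wiener_process_def rescale_wiener_def)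
  fix s t :: real assume st: "0 \<le> s" "s < t"
  let ?D = "\<lambda>\<omega>. W (c * t) \<omega> - W (c * s) \<omega>"
  let ?r = "1 / sqrt c"
  have cst: "0 \<le> c * s" "c * s < c * t" and r: "0 < ?r"
    using st c by simp_all
  have inc: "indep_set (sets (F (c * s))) {?D -` A \<inter> space M |A. A \<in> sets borel}"
      "indep_vars (\<lambda>_. borel) (\<lambda>j \<omega>. ?D \<omega> $ j) UNIV"
      "distributed M lborel (\<lambda>\<omega>. ?D \<omega> $ j) (normal_density 0 (sqrt (c * t - c * s)))" for j
    using W cst unfolding wiener_process_def by simp_all
  show "indep_set (sets (F (c * s)))
      {(\<lambda>\<omega>. rescale_wiener c W t \<omega> - rescale_wiener c W s \<omega>) -` A \<inter> space M |A. A \<in> sets borel}"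
    (is "indep_set _ ?G")
  proof -
    \<comment> \<open>A preimage under the scaled increment is the preimage, under the increment itself, of a
      scaled Borel set.\<close>
    have "?G \<subseteq> {?D -` A \<inter> space M |A. A \<in> sets borel}"
    proof safe
      fix A :: "(real ^ 'm) set" assume "A \<in> sets borel"
      then have "(\<lambda>x. ?r *\<^sub>R x) -` A \<in> sets borel"
        using measurable_sets[of "\<lambda>x :: real ^ 'm. ?r *\<^sub>R x" borel borel A] by simp
      moreover have "(\<lambda>\<omega>. rescale_wiener c W t \<omega> - rescale_wiener c W s \<omega>) -` A
          = ?D -` ((\<lambda>x. ?r *\<^sub>R x) -` A)"
        by (auto simp: rescale_wiener_diff)
      ultimately show "\<exists>B. (\<lambda>\<omega>. rescale_wiener c W t \<omega> - rescale_wiener c W s \<omega>) -` A \<inter> space M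
          = ?D -` B \<inter> space M \<and> B \<in> sets borel"
        by (intro exI[of _ "(\<lambda>x. ?r *\<^sub>R x) -` A"]) simp
    qed
    then show ?thesis
      using inc(1) unfolding indep_sets2_eq by (meson subset_trans subsetD)
  qed
  have "indep_vars (\<lambda>_. borel) (\<lambda>j \<omega>. ?r * ?D \<omega> $ j) UNIV"
    using inc(2) by (rule indep_vars_compose2) simp
  then show "indep_vars (\<lambda>_. borel)
      (\<lambda>j \<omega>. (rescale_wiener c W t \<omega> - rescale_wiener c W s \<omega>) $ j) UNIV"
    by (simp add: rescale_wiener_diff)
  fix j :: 'm
  have "distributed M lborel (\<lambda>\<omega>. 0 + ?r * ?D \<omega> $ j)
      (normal_density (0 + ?r * 0) (\<bar>?r\<bar> * sqrt (c * t - c * s)))"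
    using cst r by (intro normal_density_affine inc(3)) auto
  moreover have "\<bar>?r\<bar> * sqrt (c * t - c * s) = sqrt (t - s)"
    using c by (simp add: right_diff_distrib[symmetric] real_sqrt_mult)
  ultimately show "distributed M lborel
      (\<lambda>\<omega>. (rescale_wiener c W t \<omega> - rescale_wiener c W s \<omega>) $ j) (normal_density 0 (sqrt (t - s)))"
    by (simp add: rescale_wiener_diff)
qed

text \<open>Rescaling commutes with formal differentiation, which is why the noise and the Wiener process
  are scaled by the same factor \<open>1 / sqrt c\<close>: in \<open>- \<integral> \<phi>'(t / c) / c W(t) dt\<close> the inner derivative
  is absorbed by the substitution \<open>t = c s\<close>.\<close>

lemma formal_derivative_rescale:
  assumes WN: "formal_derivative M W N" and c: "0 < c"
  shows "formal_derivative M (rescale_wiener c W) (rescale_noise c N)"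
  unfolding formal_derivative_def
proof (intro allI impI)
  fix \<phi> assume \<phi>: "test_function \<phi>"
  have "AE \<omega> in M. N (\<lambda>t. \<phi> (t / c)) \<omega> = - (LINT t|lborel. deriv (\<lambda>t. \<phi> (t / c)) t *\<^sub>R W t \<omega>)"
    using WN test_function_rescale[OF \<phi> c] by (simp add: formal_derivative_def)
  then show "AE \<omega> in M. rescale_noise c N \<phi> \<omega>
      = - (LINT t|lborel. deriv \<phi> t *\<^sub>R rescale_wiener c W t \<omega>)"
  proof eventually_elim
    case (elim \<omega>)
    have "(LINT t|lborel. deriv (\<lambda>t. \<phi> (t / c)) t *\<^sub>R W t \<omega>)
        = c *\<^sub>R (LINT t|lborel. (deriv \<phi> t / c) *\<^sub>R W (c * t) \<omega>)"
      using lborel_integral_real_affine[of c "\<lambda>t. (deriv \<phi> (t / c) / c) *\<^sub>R W t \<omega>" 0] c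
      by (simp add: deriv_test_function_rescale[OF \<phi>])
    also have "\<dots> = (LINT t|lborel. c *\<^sub>R (deriv \<phi> t / c) *\<^sub>R W (c * t) \<omega>)"
      by (rule integral_scaleR_right[symmetric])
    also have "\<dots> = (LINT t|lborel. deriv \<phi> t *\<^sub>R W (c * t) \<omega>)"
      using c by simp
    finally have *: "(LINT t|lborel. deriv (\<lambda>t. \<phi> (t / c)) t *\<^sub>R W t \<omega>)
      = (LINT t|lborel. deriv \<phi> t *\<^sub>R W (c * t) \<omega>)" .
    have "(LINT t|lborel. deriv \<phi> t *\<^sub>R rescale_wiener c W t \<omega>)
        = (LINT t|lborel. (1 / sqrt c) *\<^sub>R deriv \<phi> t *\<^sub>R W (c * t) \<omega>)"
      by (simp add: rescale_wiener_def mult.commute)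
    also have "\<dots> = (1 / sqrt c) *\<^sub>R (LINT t|lborel. deriv \<phi> t *\<^sub>R W (c * t) \<omega>)"
      by (rule integral_scaleR_right)
    finally show ?case
      using elim * by (simp add: rescale_noise_def)
  qed
qed

section \<open>Stochastic integrals in a new clock\<close>

lemma progressively_measurable_rescale:
  fixes H :: "real \<Rightarrow> 'w \<Rightarrow> real ^ 'm ^ 'k"
  assumes H: "progressively_measurable F H" and c: "0 < c"
  shows "progressively_measurable (\<lambda>s. F (c * s)) (\<lambda>u \<omega>. r *\<^sub>R H (c * u) \<omega>)"
  unfolding progressively_measurable_def
proof (intro allI impI)
  fix t :: real assume t: "0 \<le> t"
  have "(\<lambda>u. c * u) \<in> restrict_space borel {0..t} \<rightarrow>\<^sub>M restrict_space borel {0..c * t}"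
    using c by (intro measurable_restrict_space3) auto
  then have clock: "(\<lambda>(u, \<omega>). (c * u, \<omega>)) \<in> restrict_space borel {0..t} \<Otimes>\<^sub>M F (c * t)
      \<rightarrow>\<^sub>M restrict_space borel {0..c * t} \<Otimes>\<^sub>M F (c * t)"
    unfolding case_prod_unfold
    by (intro measurable_Pair measurable_compose[OF measurable_fst] measurable_snd)
  have "(\<lambda>(u, \<omega>). H u \<omega>) \<in> borel_measurable (restrict_space borel {0..c * t} \<Otimes>\<^sub>M F (c * t))"
    using H t c by (simp add: progressively_measurable_def)
  from measurable_compose[OF clock this]
  have "(\<lambda>x. r *\<^sub>R H (c * fst x) (snd x)) \<in> borel_measurable (restrict_space borel {0..t} \<Otimes>\<^sub>M F (c * t))"
    by (intro borel_measurable_scaleR borel_measurable_const) (simp add: case_prod_unfold)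
  then show "(\<lambda>(u, \<omega>). r *\<^sub>R H (c * u) \<omega>) \<in> borel_measurable (restrict_space borel {0..t} \<Otimes>\<^sub>M F (c * t))"
    by (simp add: case_prod_unfold)
qed

lemma progressively_measurable_path:
  fixes H :: "real \<Rightarrow> 'w \<Rightarrow> real ^ 'm ^ 'k"
  assumes "progressively_measurable F H" and "0 \<le> t" and "\<omega> \<in> space (F t)"
  shows "(\<lambda>u. indicator {0..t} u *\<^sub>R H u \<omega>) \<in> borel_measurable borel"
proof -
  have "(\<lambda>(u, \<omega>). H u \<omega>) \<in> borel_measurable (restrict_space borel {0..t} \<Otimes>\<^sub>M F t)"
    using assms by (simp add: progressively_measurable_def)
  from measurable_compose[OF measurable_Pair2'[OF assms(3)] this]
  have "(\<lambda>u. H u \<omega>) \<in> borel_measurable (restrict_space borel {0..t})"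
    by simp
  then show ?thesis
    by (subst (asm) borel_measurable_restrict_space_iff) simp_all
qed

lemma simple_process_rescale:
  assumes "0 < c"
  shows "simple_process n (\<lambda>i. p i / c) (\<lambda>i \<omega>. r *\<^sub>R \<eta> i \<omega>) u \<omega> = r *\<^sub>R simple_process n p \<eta> (c * u) \<omega>"
proof -
  have "indicator {p i / c<..p (Suc i) / c} u = (indicator {p i<..p (Suc i)} (c * u) :: real)" for i
    using assms by (simp add: indicator_def field_simps)
  then show ?thesis
    by (simp only: simple_process_def scaleR_sum_right scaleR_scaleR mult.commute)
qed

lemma matrix_vector_mult_scaleR_cancel:
  fixes A :: "real ^ 'm ^ 'k"
  assumes "0 < c"
  shows "(sqrt c *\<^sub>R A) *v ((1 / sqrt c) *\<^sub>R x) = A *v x"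
  using assms by (simp add: matrix_vector_mult_scaleR scaleR_matrix_vector_assoc[symmetric])

text \<open>If the simple processes with jump times \<open>p i\<close> and values \<open>\<eta> i\<close> approximate \<open>H\<close>, then those with
  jump times \<open>p i / c\<close> and values \<open>sqrt c \<eta> i\<close> approximate the rescaled integrand, and they have the
  same integrals, because \<open>sqrt c\<close> cancels the \<open>1 / sqrt c\<close> in the rescaled Wiener process. The
  hypothesis on \<open>F\<close> makes every path of \<open>H\<close> over \<open>M\<close> measurable on \<open>[0, c t]\<close>, as the substitution in
  the \<open>L\<^sup>2\<close> distance requires.\<close>

lemma has_ito_integral_rescale:
  fixes H :: "real \<Rightarrow> 'w \<Rightarrow> real ^ 'm ^ 'k"
  assumes J: "has_ito_integral M F W H (c * t) J" and c: "0 < c" and t: "0 \<le> t"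
    and F: "space (F (c * t)) = space M"
  shows "has_ito_integral M (\<lambda>s. F (c * s)) (rescale_wiener c W) (\<lambda>u \<omega>. sqrt c *\<^sub>R H (c * u) \<omega>) t J"
proof -
  from J obtain n p \<eta> where H: "progressively_measurable F H"
    and simple: "\<And>k. simple_integrand M F (c * t) (n k) (p k) (\<eta> k)"
    and L2: "\<And>\<epsilon>. 0 < \<epsilon> \<Longrightarrow> (\<lambda>k. measure M {\<omega>\<in>space M. ennreal \<epsilon> < (\<integral>\<^sup>+u\<in>{0..c * t}.
      ennreal ((norm (H u \<omega> - simple_process (n k) (p k) (\<eta> k) u \<omega>))\<^sup>2) \<partial>lborel)}) \<longlonglongrightarrow> 0"
    and lim: "tends_in_prob M (\<lambda>k. simple_integral W (n k) (p k) (\<eta> k)) J"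
    unfolding has_ito_integral_def by blast
  let ?p = "\<lambda>k i. p k i / c" and ?\<eta> = "\<lambda>k i \<omega>. sqrt c *\<^sub>R \<eta> k i \<omega>"
  have "simple_integrand M (\<lambda>s. F (c * s)) t (n k) (?p k) (?\<eta> k)" for k
    unfolding simple_integrand_def
  proof (intro allI impI conjI)
    fix i assume i: "i < n k"
    with simple[of k] obtain B where B: "0 \<le> p k i" "p k i \<le> p k (Suc i)" "p k (Suc i) \<le> c * t"
      "\<eta> k i \<in> borel_measurable (F (p k i))" "\<And>\<omega>. \<omega> \<in> space M \<Longrightarrow> norm (\<eta> k i \<omega>) \<le> B"
      unfolding simple_integrand_def by blast
    then show "0 \<le> p k i / c" "p k i / c \<le> p k (Suc i) / c" "p k (Suc i) / c \<le> t"
      "(\<lambda>\<omega>. sqrt c *\<^sub>R \<eta> k i \<omega>) \<in> borel_measurable (F (c * (p k i / c)))"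
      using c by (simp_all add: divide_right_mono pos_divide_le_eq mult.commute)
    show "\<exists>B. \<forall>\<omega>\<in>space M. norm (sqrt c *\<^sub>R \<eta> k i \<omega>) \<le> B"
      using B(5) c by (intro exI[of _ "sqrt c * B"]) (auto intro!: mult_left_mono)
  qed
  moreover have "(\<integral>\<^sup>+u\<in>{0..t}. ennreal ((norm (sqrt c *\<^sub>R H (c * u) \<omega>
          - simple_process (n k) (?p k) (?\<eta> k) u \<omega>))\<^sup>2) \<partial>lborel)
      = (\<integral>\<^sup>+u\<in>{0..c * t}. ennreal ((norm (H u \<omega> - simple_process (n k) (p k) (\<eta> k) u \<omega>))\<^sup>2) \<partial>lborel)"
    (is "?L = ?R") if \<omega>: "\<omega> \<in> space M" for k \<omega>
  proof -
    \<comment> \<open>The square of the factor \<open>sqrt c\<close> is the Jacobian of the substitution, so the \<open>L\<^sup>2\<close> distances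
      in the two clocks are equal.\<close>
    let ?f = "\<lambda>u. ennreal ((norm (H u \<omega> - simple_process (n k) (p k) (\<eta> k) u \<omega>))\<^sup>2) * indicator {0..c * t} u"
    have H': "(\<lambda>u. indicator {0..c * t} u *\<^sub>R H u \<omega>) \<in> borel_measurable borel"
      using progressively_measurable_path[OF H] t c \<omega> F by simp
    have "?f = (\<lambda>u. ennreal ((norm (indicator {0..c * t} u *\<^sub>R H u \<omega>
        - indicator {0..c * t} u *\<^sub>R simple_process (n k) (p k) (\<eta> k) u \<omega>))\<^sup>2))"
      by (auto simp: fun_eq_iff indicator_def)
    moreover have "\<dots> \<in> borel_measurable borel"
      using H' unfolding simple_process_def by measurable
    ultimately have f: "?f \<in> borel_measurable borel"
      by simp
    have "?L = (\<integral>\<^sup>+u. ennreal c * ?f (c * u) \<partial>lborel)"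
    proof (rule nn_integral_cong)
      fix u
      have ind: "indicator {0..c * t} (c * u) = (indicator {0..t} u :: ennreal)"
        using c by (simp add: indicator_def zero_le_mult_iff)
      have "sqrt c *\<^sub>R H (c * u) \<omega> - simple_process (n k) (?p k) (?\<eta> k) u \<omega>
          = sqrt c *\<^sub>R (H (c * u) \<omega> - simple_process (n k) (p k) (\<eta> k) (c * u) \<omega>)"
        by (simp only: simple_process_rescale[OF c] scaleR_diff_right)
      then show "ennreal ((norm (sqrt c *\<^sub>R H (c * u) \<omega>
          - simple_process (n k) (?p k) (?\<eta> k) u \<omega>))\<^sup>2) * indicator {0..t} u = ennreal c * ?f (c * u)"
        using c by (simp add: ind power_mult_distrib ennreal_mult mult.assoc)
    qed
    also have "\<dots> = ennreal c * (\<integral>\<^sup>+u. ?f (c * u) \<partial>lborel)"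
      using f by (intro nn_integral_cmult) simp
    also have "\<dots> = ?R"
      using nn_integral_real_affine[OF f, of c 0] c by simp
    finally show ?thesis .
  qed
  then have "{\<omega>\<in>space M. ennreal \<epsilon> < (\<integral>\<^sup>+u\<in>{0..t}. ennreal ((norm (sqrt c *\<^sub>R H (c * u) \<omega>
          - simple_process (n k) (?p k) (?\<eta> k) u \<omega>))\<^sup>2) \<partial>lborel)}
      = {\<omega>\<in>space M. ennreal \<epsilon> < (\<integral>\<^sup>+u\<in>{0..c * t}. ennreal ((norm (H u \<omega>
          - simple_process (n k) (p k) (\<eta> k) u \<omega>))\<^sup>2) \<partial>lborel)}" for \<epsilon> k
    by auto
  moreover have "simple_integral (rescale_wiener c W) (n k) (?p k) (?\<eta> k)
      = simple_integral W (n k) (p k) (\<eta> k)" for k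
    using c by (simp add: fun_eq_iff simple_integral_def rescale_wiener_diff
        matrix_vector_mult_scaleR_cancel[OF c])
  ultimately show ?thesis
    unfolding has_ito_integral_def using progressively_measurable_rescale[OF H c] L2 lim
    by (intro conjI exI[of _ n] exI[of _ ?p] exI[of _ ?\<eta>]) simp_all
qed

text \<open>Multiplication by \<open>c\<close> turns partitions of \<open>[0, t]\<close> with mesh tending to zero into such partitions
  of \<open>[0, c t]\<close>, so every sequence of trapezoidal sums in the new clock is one in the old clock.\<close>

lemma has_stratonovich_integral_rescale:
  fixes H :: "real \<Rightarrow> 'w \<Rightarrow> real ^ 'm ^ 'k"
  assumes J: "has_stratonovich_integral M F W H (c * t) J" and c: "0 < c"
  shows "has_stratonovich_integral M (\<lambda>s. F (c * s)) (rescale_wiener c W)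
    (\<lambda>u \<omega>. sqrt c *\<^sub>R H (c * u) \<omega>) t J"
  unfolding has_stratonovich_integral_def
proof (intro conjI allI impI)
  show "progressively_measurable (\<lambda>s. F (c * s)) (\<lambda>u \<omega>. sqrt c *\<^sub>R H (c * u) \<omega>)"
    using J c by (intro progressively_measurable_rescale) (simp_all add: has_stratonovich_integral_def)
  fix n p
  assume part: "\<forall>k. is_partition t (n k) (p k)"
    and mesh: "\<forall>\<delta>>0. \<forall>\<^sub>F k in sequentially. \<forall>i<n k. p k (Suc i) - p k i < \<delta>"
  have "\<forall>k. is_partition (c * t) (n k) (\<lambda>i. c * p k i)"
    using part c by (simp add: is_partition_def)
  moreover have "\<forall>\<delta>>0. \<forall>\<^sub>F k in sequentially. \<forall>i<n k. c * p k (Suc i) - c * p k i < \<delta>"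
  proof (intro allI impI)
    fix \<delta> :: real assume "0 < \<delta>"
    with c have "\<forall>\<^sub>F k in sequentially. \<forall>i<n k. p k (Suc i) - p k i < \<delta> / c"
      using mesh by simp
    then show "\<forall>\<^sub>F k in sequentially. \<forall>i<n k. c * p k (Suc i) - c * p k i < \<delta>"
      by eventually_elim (use c in \<open>simp add: field_simps\<close>)
  qed
  ultimately have "tends_in_prob M (\<lambda>k \<omega>. \<Sum>i<n k.
      ((1/2) *\<^sub>R (H (c * p k i) \<omega> + H (c * p k (Suc i)) \<omega>)) *v
      (W (c * p k (Suc i)) \<omega> - W (c * p k i) \<omega>)) J"
    using J[unfolded has_stratonovich_integral_def, THEN conjunct2, rule_format,
        of n "\<lambda>k i. c * p k i"] by simp
  moreover have "((1/2) *\<^sub>R (sqrt c *\<^sub>R A + sqrt c *\<^sub>R B)) *v ((1 / sqrt c) *\<^sub>R x)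
      = ((1/2) *\<^sub>R (A + B)) *v x" for A B :: "real ^ 'm ^ 'k" and x
    using matrix_vector_mult_scaleR_cancel[OF c, of "(1/2) *\<^sub>R (A + B)" x]
    by (simp add: scaleR_add_right mult.commute)
  ultimately show "tends_in_prob M (\<lambda>k \<omega>. \<Sum>i<n k.
      ((1/2) *\<^sub>R (sqrt c *\<^sub>R H (c * p k i) \<omega> + sqrt c *\<^sub>R H (c * p k (Suc i)) \<omega>)) *v
      (rescale_wiener c W (p k (Suc i)) \<omega> - rescale_wiener c W (p k i) \<omega>)) J"
    by (simp only: rescale_wiener_diff)
qed

lemma has_stochastic_integral_rescale:
  fixes H :: "real \<Rightarrow> 'w \<Rightarrow> real ^ 'm ^ 'k"
  assumes "has_stochastic_integral conv M F W H (c * t) J" and "0 < c" and "0 \<le> t"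
    and "space (F (c * t)) = space M"
  shows "has_stochastic_integral conv M (\<lambda>s. F (c * s)) (rescale_wiener c W)
    (\<lambda>u \<omega>. sqrt c *\<^sub>R H (c * u) \<omega>) t J"
  using assms has_ito_integral_rescale has_stratonovich_integral_rescale
  by (cases conv) auto

section \<open>The system in a new clock\<close>

lemma state_equation_rescale:
  assumes "state_equation M k g \<sigma> X \<xi>" and c: "0 < c"
  shows "state_equation M (k / c) g \<sigma> (\<lambda>s. X (c * s)) (\<lambda>s. \<xi> (c * s))"
  using assms(1) unfolding state_equation_def
proof eventually_elim
  case (elim \<omega>)
  show ?case
  proof (intro allI impI)
    fix t :: real assume "0 \<le> t"
    with c have "0 \<le> c * t" by simp
    with elim obtain D where D: "((\<lambda>u. X u \<omega>) has_vector_derivative D) (at (c * t) within {0..})"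
      and eq: "k *\<^sub>R D = - g (X (c * t) \<omega>) + \<sigma> (X (c * t) \<omega>) *v \<xi> (c * t) \<omega>"
      by blast
    have "((\<lambda>u. c * u) has_vector_derivative c) (at t within {0..})"
      by (auto intro!: derivative_eq_intros simp: has_real_derivative_iff_has_vector_derivative[symmetric])
    moreover have "((\<lambda>u. X u \<omega>) has_vector_derivative D) (at (c * t) within (\<lambda>u. c * u) ` {0..})"
      by (rule has_vector_derivative_within_subset[OF D]) (use c in auto)
    ultimately have "((\<lambda>u. X (c * u) \<omega>) has_vector_derivative c *\<^sub>R D) (at t within {0..})"
      using vector_diff_chain_within[of "\<lambda>u. c * u" c t "{0..}" "\<lambda>u. X u \<omega>" D] by (simp add: o_def)
    then show "\<exists>D. ((\<lambda>u. X (c * u) \<omega>) has_vector_derivative D) (at t within {0..}) \<and>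
        (k / c) *\<^sub>R D = - g (X (c * t) \<omega>) + \<sigma> (X (c * t) \<omega>) *v \<xi> (c * t) \<omega>"
      using eq c by (intro exI[of _ "c *\<^sub>R D"]) simp
  qed
qed

lemma set_lebesgue_rescale:
  fixes f :: "real \<Rightarrow> 'a :: euclidean_space"
  assumes c: "0 < c"
  shows set_integrable_rescale:
      "set_integrable lborel {0..c * t} f \<Longrightarrow> set_integrable lborel {0..t} (\<lambda>u. c *\<^sub>R f (c * u))"
    and set_integral_rescale:
      "(LINT u:{0..t}|lborel. c *\<^sub>R f (c * u)) = (LINT u:{0..c * t}|lborel. f u)"
proof -
  have ind: "indicator {0..c * t} (c * u) = (indicator {0..t} u :: real)" for u
    using c by (simp add: indicator_def zero_le_mult_iff)
  let ?f = "\<lambda>u. indicator {0..c * t} u *\<^sub>R f u"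
  show "set_integrable lborel {0..t} (\<lambda>u. c *\<^sub>R f (c * u))" if "set_integrable lborel {0..c * t} f"
  proof -
    have "integrable lborel (\<lambda>u. ?f (0 + c * u))"
      using that c unfolding set_integrable_def by (intro lborel_integrable_real_affine) auto
    then have "integrable lborel (\<lambda>u. c *\<^sub>R ?f (c * u))"
      by (intro integrable_scaleR_right) simp
    then show ?thesis
      by (simp only: set_integrable_def ind scaleR_left_commute)
  qed
  have "(LINT u:{0..t}|lborel. c *\<^sub>R f (c * u)) = (LINT u|lborel. c *\<^sub>R ?f (c * u))"
    by (simp only: set_lebesgue_integral_def ind scaleR_left_commute)
  also have "\<dots> = c *\<^sub>R (LINT u|lborel. ?f (c * u))"
    by (rule integral_scaleR_right)
  also have "\<dots> = (LINT u:{0..c * t}|lborel. f u)"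
    using lborel_integral_real_affine[of c ?f 0] c by (simp add: set_lebesgue_integral_def)
  finally show "(LINT u:{0..t}|lborel. c *\<^sub>R f (c * u)) = (LINT u:{0..c * t}|lborel. f u)" .
qed

lemma filter_equation_rescale:
  fixes \<xi> :: "real \<Rightarrow> 'w \<Rightarrow> real ^ 'm"
  assumes M: "prob_space M" and F: "\<And>t. space (F t) = space M"
    and eq: "filter_equation conv M F A B N \<xi>" and c: "0 < c"
  shows "filter_equation conv M (\<lambda>s. F (c * s)) (\<lambda>z. c *\<^sub>R A z) (\<lambda>z. sqrt c *\<^sub>R B z)
    (rescale_noise c N) (\<lambda>s. \<xi> (c * s))"
proof -
  from eq obtain W where W: "wiener_process M F W" and WN: "formal_derivative M W N"
    and int: "\<And>t. 0 \<le> t \<Longrightarrow> \<exists>J. has_stochastic_integral conv M F W (\<lambda>u \<omega>. B (\<xi> u \<omega>)) t J \<and>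
      (AE \<omega> in M. set_integrable lborel {0..t} (\<lambda>u. A (\<xi> u \<omega>)) \<and>
        \<xi> t \<omega> = \<xi> 0 \<omega> + (LINT u:{0..t}|lborel. A (\<xi> u \<omega>)) + J \<omega>)"
    unfolding filter_equation_def by blast
  show ?thesis
    unfolding filter_equation_def
  proof (intro exI[of _ "rescale_wiener c W"] conjI allI impI)
    show "wiener_process M (\<lambda>s. F (c * s)) (rescale_wiener c W)"
      by (rule wiener_process_rescale[OF M W c])
    show "formal_derivative M (rescale_wiener c W) (rescale_noise c N)"
      by (rule formal_derivative_rescale[OF WN c])
    fix t :: real assume t: "0 \<le> t"
    with c int[of "c * t"] obtain J where
      J: "has_stochastic_integral conv M F W (\<lambda>u \<omega>. B (\<xi> u \<omega>)) (c * t) J"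
      and eqJ: "AE \<omega> in M. set_integrable lborel {0..c * t} (\<lambda>u. A (\<xi> u \<omega>)) \<and>
        \<xi> (c * t) \<omega> = \<xi> 0 \<omega> + (LINT u:{0..c * t}|lborel. A (\<xi> u \<omega>)) + J \<omega>"
      by auto
    have "AE \<omega> in M. set_integrable lborel {0..t} (\<lambda>u. c *\<^sub>R A (\<xi> (c * u) \<omega>)) \<and>
        \<xi> (c * t) \<omega> = \<xi> (c * 0) \<omega> + (LINT u:{0..t}|lborel. c *\<^sub>R A (\<xi> (c * u) \<omega>)) + J \<omega>"
      using eqJ
    proof eventually_elim
      case (elim \<omega>)
      then show ?case
        using set_integrable_rescale[OF c, of t "\<lambda>u. A (\<xi> u \<omega>)"]
          set_integral_rescale[OF c, of t "\<lambda>u. A (\<xi> u \<omega>)"] by simp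
    qed
    then show "\<exists>J. has_stochastic_integral conv M (\<lambda>s. F (c * s)) (rescale_wiener c W)
          (\<lambda>u \<omega>. sqrt c *\<^sub>R B (\<xi> (c * u) \<omega>)) t J \<and>
        (AE \<omega> in M. set_integrable lborel {0..t} (\<lambda>u. c *\<^sub>R A (\<xi> (c * u) \<omega>)) \<and>
          \<xi> (c * t) \<omega> = \<xi> (c * 0) \<omega> + (LINT u:{0..t}|lborel. c *\<^sub>R A (\<xi> (c * u) \<omega>)) + J \<omega>)"
      using has_stochastic_integral_rescale[OF J c t F] by blast
  qed
qed

lemma solves_system_rescale:
  assumes M: "prob_space M" and c: "0 < c" and sys: "solves_system conv M F k g \<sigma> A B N X \<xi>"
  shows "solves_system conv M (\<lambda>s. F (c * s)) (k / c) g \<sigma> (\<lambda>z. c *\<^sub>R A z) (\<lambda>z. sqrt c *\<^sub>R B z)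
    (rescale_noise c N) (\<lambda>s. X (c * s)) (\<lambda>s. \<xi> (c * s))"
proof -
  from sys have F: "filtration (space M) F" and sub: "\<And>t. subalgebra M (F t)"
    and XF: "continuous_adapted M F X" and \<xi>F: "continuous_adapted M F \<xi>"
    and N: "standard_white_noise M N" and state: "state_equation M k g \<sigma> X \<xi>"
    and filter: "filter_equation conv M F A B N \<xi>"
    by (simp_all add: solves_system_def)
  have "filtration (space M) (\<lambda>s. F (c * s))"
  proof
    fix i j :: real assume "i \<le> j"
    then show "sets (F (c * i)) \<subseteq> sets (F (c * j))"
      using c by (intro filtration.sets_F_mono[OF F]) simp
  qed (rule filtration.space_F[OF F])
  then show ?thesis
    unfolding solves_system_def
    by (intro conjI allI sub continuous_adapted_rescale[OF XF c] continuous_adapted_rescale[OF \<xi>F c]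
        standard_white_noise_rescale[OF N c] state_equation_rescale[OF state c]
        filter_equation_rescale[OF M filtration.space_F[OF F] filter c])
qed

text \<open>Scaling by \<open>1 / c\<close> undoes scaling by \<open>c\<close>.\<close>

lemma solves_system_rescale_iff:
  assumes M: "prob_space M" and c: "0 < c"
  shows "solves_system conv M F k g \<sigma> A B N X \<xi> \<longleftrightarrow>
    solves_system conv M (\<lambda>s. F (c * s)) (k / c) g \<sigma> (\<lambda>z. c *\<^sub>R A z) (\<lambda>z. sqrt c *\<^sub>R B z)
      (rescale_noise c N) (\<lambda>s. X (c * s)) (\<lambda>s. \<xi> (c * s))" (is "?old \<longleftrightarrow> ?new")
proof
  show "?old \<Longrightarrow> ?new" by (rule solves_system_rescale[OF M c])
  have "0 < 1 / c" using c by simp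
  assume ?new
  from solves_system_rescale[OF M \<open>0 < 1 / c\<close> this] show ?old
    using c by (simp add: rescale_noise_inverse real_sqrt_divide)
qed

theorem theorem1:
  fixes a \<tau> :: real
    and xhat :: "real ^ 'n"
    and V :: "real ^ 'n \<Rightarrow> real"
    and \<sigma> :: "real ^ 'n \<Rightarrow> real ^ 'm ^ 'n"
    and \<alpha> :: "real ^ 'm \<Rightarrow> real ^ 'm"
    and \<beta> :: "real ^ 'm \<Rightarrow> real ^ 'm ^ 'm"
    and conv :: noise_convention
    and M :: "'w measure"
    and F :: "real \<Rightarrow> 'w measure"
    and X :: "real \<Rightarrow> 'w \<Rightarrow> real ^ 'n"
    and \<xi> :: "real \<Rightarrow> 'w \<Rightarrow> real ^ 'm"
  assumes "\<tau> > 0" and "a * \<tau> < 1"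
    and "\<forall>x. V differentiable (at x)"
    and "prob_space M"
  defines "Vt \<equiv> \<lambda>x. V x + a / 2 * (norm (x - xhat))\<^sup>2"
    and "t \<equiv> \<lambda>s. (1 - a * \<tau>) * s"
  shows "(\<forall>N. solves_system conv M F (1 - a * \<tau>) (gradient Vt) \<sigma> \<alpha> \<beta> N X \<xi> \<longleftrightarrow>
              solves_system conv M (\<lambda>s. F (t s)) 1 (gradient Vt) \<sigma>
                (\<lambda>z. (1 - a * \<tau>) *\<^sub>R \<alpha> z) (\<lambda>z. sqrt (1 - a * \<tau>) *\<^sub>R \<beta> z)
                (rescale_noise (1 - a * \<tau>) N) (\<lambda>s. X (t s)) (\<lambda>s. \<xi> (t s))) \<and>
         ((\<exists>N. solves_system conv M F (1 - a * \<tau>) (gradient Vt) \<sigma> \<alpha> \<beta> N X \<xi>) \<longleftrightarrow>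
          (\<exists>N'. solves_system conv M (\<lambda>s. F (t s)) 1 (gradient Vt) \<sigma>
                (\<lambda>z. (1 - a * \<tau>) *\<^sub>R \<alpha> z) (\<lambda>z. sqrt (1 - a * \<tau>) *\<^sub>R \<beta> z)
                N' (\<lambda>s. X (t s)) (\<lambda>s. \<xi> (t s))))"
proof -
  have c: "0 < 1 - a * \<tau>"
    using \<open>a * \<tau> < 1\<close> by simp
  have iff: "solves_system conv M F (1 - a * \<tau>) (gradient Vt) \<sigma> \<alpha> \<beta> N X \<xi> \<longleftrightarrow>
      solves_system conv M (\<lambda>s. F (t s)) 1 (gradient Vt) \<sigma>
        (\<lambda>z. (1 - a * \<tau>) *\<^sub>R \<alpha> z) (\<lambda>z. sqrt (1 - a * \<tau>) *\<^sub>R \<beta> z)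
        (rescale_noise (1 - a * \<tau>) N) (\<lambda>s. X (t s)) (\<lambda>s. \<xi> (t s))" for N
    using solves_system_rescale_iff[OF \<open>prob_space M\<close> c, of conv F "1 - a * \<tau>"] c
    by (simp add: t_def)
  \<comment> \<open>Every noise \<open>N'\<close> in the new clock is the rescaling of a noise in the old one.\<close>
  have surj: "rescale_noise (1 - a * \<tau>) (rescale_noise (1 / (1 - a * \<tau>)) N') = N'"
    for N' :: "(real \<Rightarrow> real) \<Rightarrow> 'w \<Rightarrow> real ^ 'm"
    using rescale_noise_inverse[of "1 / (1 - a * \<tau>)" N'] c by simp
  show ?thesis
  proof (intro conjI allI iffI; (elim exE)?)
    fix N'
    assume "solves_system conv M (\<lambda>s. F (t s)) 1 (gradient Vt) \<sigma>
        (\<lambda>z. (1 - a * \<tau>) *\<^sub>R \<alpha> z) (\<lambda>z. sqrt (1 - a * \<tau>) *\<^sub>R \<beta> z)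
        N' (\<lambda>s. X (t s)) (\<lambda>s. \<xi> (t s))"
    then show "\<exists>N. solves_system conv M F (1 - a * \<tau>) (gradient Vt) \<sigma> \<alpha> \<beta> N X \<xi>"
      using iff[of "rescale_noise (1 / (1 - a * \<tau>)) N'"] surj[of N'] by auto
  qed (use iff in auto)
qed

end
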